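(* Let $f:\mathbb{R}^n\to\mathbb{R}$ and $h:\mathbb{R}^n\to\mathbb{R}^m$ be continuously differentiable, let $g:\mathbb{R}^n\to\mathbb{R}\cup\{+\infty\}$ be a closed proper convex non-differentiable function, and let $\mu>0$. Consider the system $\mathcal{P}$ with state $x(t)\in\mathbb{R}^n$, inputs $\alpha(t)\in\mathbb{R}^n$, $\lambda(t)\in\mathbb{R}^m$ and outputs $y_1(t)\in\mathbb{R}^n$, $y_2(t)\in\mathbb{R}^m$, $$\dot x=-\nabla f(x)-\nabla M_{\mu g}(x+\mu\alpha)-J_h^\top(x)\lambda,\qquad y_1=x-\mathrm{prox}_{\mu g}(x+\mu\alpha),\qquad y_2=h(x),$$ and let $y=[y_1^\top,y_2^\top]^\top\in\mathbb{R}^{n+m}$. Let $(x^\star,\alpha^\star,\lambda^\star)$ be an equilibrium point of $\mathcal{P}$, and let $y^\star$ be the corresponding equilibrium output. Then $(x^\star,\alpha^\star,\lambda^\star)$ is a stationary point of the problem $$\min_{x,z\in\mathbb{R}^n}\; f(x)+g(z)\quad\text{s.t.}\quad x-z=0,\;\; h(x)=0$$ if and only if $y^\star=0$.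
   Context: $J_h(x)\in\mathbb{R}^{m\times n}$ is the Jacobian of $h$. For $\mu>0$, $\mathrm{prox}_{\mu g}(v)=\arg\min_{x\in\mathbb{R}^n}\left(g(x)+\frac1{2\mu}\|x-v\|_2^2\right)$ and $M_{\mu g}(v)=\inf_{x\in\mathbb{R}^n}\left(g(x)+\frac1{2\mu}\|x-v\|_2^2\right)$ is the Moreau envelope, which is continuously differentiable with $\nabla M_{\mu g}(v)=\frac1\mu\bigl(v-\mathrm{prox}_{\mu g}(v)\bigr)$. A triple $(x^\star,\alpha^\star,\lambda^\star)$ is an equilibrium point of $\mathcal{P}$ if $\nabla f(x^\star)+\nabla M_{\mu g}(x^\star+\mu\alpha^\star)+J_h^\top(x^\star)\lambda^\star=0$; the equilibrium output is $y^\star=[y_1^{\star\top},y_2^{\star\top}]^\top$ with $y_1^\star=x^\star-\mathrm{prox}_{\mu g}(x^\star+\mu\alpha^\star)$, $y_2^\star=h(x^\star)$. The vectors $\alpha$ and $\lambda$ are the Lagrange multipliers of the constraints $x-z=0$ and $h(x)=0$ respectively; a triple $(x^\star,\alpha^\star,\lambda^\star)$ is a stationary point of the two-variable problem if there is $z^\star\in\mathbb{R}^n$ such that the first-order optimality conditions hold: $\nabla f(x^\star)+\alpha^\star+J_h^\top(x^\star)\lambda^\star=0$, $\alpha^\star\in\partial g(z^\star)$, $x^\star-z^\star=0$, $h(x^\star)=0$, where $\partial g(x)=\{y\in\mathbb{R}^n: g(z)\ge g(x)+y^\top(z-x)\ \forall z\in\mathrm{dom}(g)\}$. *)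

theory Defs
  imports "HOL-Analysis.Analysis"
begin

definition continuously_differentiable ::
    "('a::real_normed_vector \<Rightarrow> 'b::real_normed_vector) \<Rightarrow> bool" where
  "continuously_differentiable F \<longleftrightarrow>
     (\<exists>F'. (\<forall>x. (F has_derivative blinfun_apply (F' x)) (at x)) \<and> continuous_on UNIV F')"

text \<open>Only meaningful where \<open>f\<close> is differentiable; there the gradient is unique.\<close>

definition gradient :: "('a::real_inner \<Rightarrow> real) \<Rightarrow> 'a \<Rightarrow> 'a" where
  "gradient f x = (THE D. GDERIV f x :> D)"

text \<open>Functions with values in \<open>\<real> \<union> {+\<infinity>}\<close> are modelled as \<open>ereal\<close>-valued functions;
  the value \<open>-\<infinity>\<close> is excluded by \<open>proper\<close>.\<close>

definition dom_ext :: "('a \<Rightarrow> ereal) \<Rightarrow> 'a set" where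
  "dom_ext g = {x. g x < \<infinity>}"

definition epigraph_ext :: "('a \<Rightarrow> ereal) \<Rightarrow> ('a \<times> real) set" where
  "epigraph_ext g = {(x, r). g x \<le> ereal r}"

definition proper_ext :: "('a \<Rightarrow> ereal) \<Rightarrow> bool" where
  "proper_ext g \<longleftrightarrow> (\<forall>x. g x \<noteq> -\<infinity>) \<and> dom_ext g \<noteq> {}"

definition convex_ext :: "('a::real_vector \<Rightarrow> ereal) \<Rightarrow> bool" where
  "convex_ext g \<longleftrightarrow> convex (epigraph_ext g)"

definition closed_ext :: "('a::topological_space \<Rightarrow> ereal) \<Rightarrow> bool" where
  "closed_ext g \<longleftrightarrow> closed (epigraph_ext g)"

text \<open>A differentiable extended-valued function is real-valued and differentiable at every
  point, so indicator functions of proper nonempty subsets count as non-differentiable.\<close>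

definition differentiable_ext :: "('a::real_normed_vector \<Rightarrow> ereal) \<Rightarrow> bool" where
  "differentiable_ext g \<longleftrightarrow>
     (\<forall>x. \<bar>g x\<bar> \<noteq> \<infinity>) \<and> (\<forall>x. (\<lambda>u. real_of_ereal (g u)) differentiable (at x))"

definition subdifferential :: "('a::real_inner \<Rightarrow> ereal) \<Rightarrow> 'a \<Rightarrow> 'a set" where
  "subdifferential g x = {y. \<forall>z \<in> dom_ext g. g z \<ge> g x + ereal (y \<bullet> (z - x))}"

definition prox_objective :: "real \<Rightarrow> ('a::real_normed_vector \<Rightarrow> ereal) \<Rightarrow> 'a \<Rightarrow> 'a \<Rightarrow> ereal" where
  "prox_objective \<mu> g v x = g x + ereal (1 / (2 * \<mu>) * (norm (x - v))\<^sup>2)"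

definition prox :: "real \<Rightarrow> ('a::real_normed_vector \<Rightarrow> ereal) \<Rightarrow> 'a \<Rightarrow> 'a" where
  "prox \<mu> g v = (ARG_MIN (prox_objective \<mu> g v) x. True)"

text \<open>The infimum is finite for closed proper convex \<open>g\<close> and \<open>\<mu> > 0\<close>, so the conversion to
  \<open>real\<close> loses nothing there.\<close>

definition moreau_envelope :: "real \<Rightarrow> ('a::real_normed_vector \<Rightarrow> ereal) \<Rightarrow> 'a \<Rightarrow> real" where
  "moreau_envelope \<mu> g v = real_of_ereal (INF x. prox_objective \<mu> g v x)"

text \<open>The right-hand side of the state equation \<open>x' = F(x, \<alpha>, l)\<close>, with inputs \<open>\<alpha>\<close> and \<open>l\<close>.\<close>

definition system_field ::
    "(real^'n \<Rightarrow> real) \<Rightarrow> (real^'n \<Rightarrow> ereal) \<Rightarrow> (real^'n \<Rightarrow> real^'m) \<Rightarrow> real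
      \<Rightarrow> real^'n \<Rightarrow> real^'n \<Rightarrow> real^'m \<Rightarrow> real^'n" where
  "system_field f g h \<mu> x \<alpha> l =
     - gradient f x - gradient (moreau_envelope \<mu> g) (x + \<mu> *\<^sub>R \<alpha>)
     - transpose (jacobian h (at x)) *v l"

definition output1 :: "(real^'n \<Rightarrow> ereal) \<Rightarrow> real \<Rightarrow> real^'n \<Rightarrow> real^'n \<Rightarrow> real^'n" where
  "output1 g \<mu> x \<alpha> = x - prox \<mu> g (x + \<mu> *\<^sub>R \<alpha>)"

definition output2 :: "(real^'n \<Rightarrow> real^'m) \<Rightarrow> real^'n \<Rightarrow> real^'m" where
  "output2 h x = h x"

definition stack :: "real^'n \<Rightarrow> real^'m \<Rightarrow> real^('n + 'm)" where
  "stack u w = (\<chi> i. case i of Inl j \<Rightarrow> u $ j | Inr k \<Rightarrow> w $ k)"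

definition system_output ::
    "(real^'n \<Rightarrow> ereal) \<Rightarrow> (real^'n \<Rightarrow> real^'m) \<Rightarrow> real \<Rightarrow> real^'n \<Rightarrow> real^'n \<Rightarrow> real^('n + 'm)" where
  "system_output g h \<mu> x \<alpha> = stack (output1 g \<mu> x \<alpha>) (output2 h x)"

definition equilibrium_point ::
    "(real^'n \<Rightarrow> real) \<Rightarrow> (real^'n \<Rightarrow> ereal) \<Rightarrow> (real^'n \<Rightarrow> real^'m) \<Rightarrow> real
      \<Rightarrow> real^'n \<Rightarrow> real^'n \<Rightarrow> real^'m \<Rightarrow> bool" where
  "equilibrium_point f g h \<mu> x \<alpha> l \<longleftrightarrow>
     gradient f x + gradient (moreau_envelope \<mu> g) (x + \<mu> *\<^sub>R \<alpha>)
     + transpose (jacobian h (at x)) *v l = 0"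

lemma equilibrium_point_iff_system_field_eq_0:
  "equilibrium_point f g h \<mu> x \<alpha> l \<longleftrightarrow> system_field f g h \<mu> x \<alpha> l = 0"
proof -
  have "system_field f g h \<mu> x \<alpha> l = - (gradient f x
      + gradient (moreau_envelope \<mu> g) (x + \<mu> *\<^sub>R \<alpha>) + transpose (jacobian h (at x)) *v l)"
    by (simp add: system_field_def)
  then show ?thesis
    by (simp only: equilibrium_point_def neg_equal_0_iff_equal)
qed

text \<open>First-order optimality conditions of: minimize \<open>f x + g z\<close> subject to \<open>x - z = 0\<close> and
  \<open>h x = 0\<close>, with multipliers \<open>\<alpha>\<close> and \<open>l\<close> respectively.\<close>

definition stationary_point ::
    "(real^'n \<Rightarrow> real) \<Rightarrow> (real^'n \<Rightarrow> ereal) \<Rightarrow> (real^'n \<Rightarrow> real^'m)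
      \<Rightarrow> real^'n \<Rightarrow> real^'n \<Rightarrow> real^'m \<Rightarrow> bool" where
  "stationary_point f g h x \<alpha> l \<longleftrightarrow>
     (\<exists>z. gradient f x + \<alpha> + transpose (jacobian h (at x)) *v l = 0 \<and>
          \<alpha> \<in> subdifferential g z \<and> x - z = 0 \<and> h x = 0)"

end

theory Submission
  imports Defs
begin

text \<open>
  Write \<open>v = x + \<mu> \<alpha>\<close>. Everything rests on one characterisation of the proximal point:
  \<open>p\<close> minimises \<open>g z + \<parallel>z - v\<parallel>\<^sup>2 / (2 \<mu>)\<close> exactly when \<open>(v - p) / \<mu>\<close> is a subgradient of \<open>g\<close>
  at \<open>p\<close> (lemma \<open>prox_eq_iff_subgradient\<close>). For \<open>p = x\<close> the quotient is \<open>\<alpha>\<close>, so \<open>y\<^sub>1 = 0\<close> says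
  precisely that \<open>\<alpha>\<close> is a subgradient of \<open>g\<close> at \<open>x\<close>. Together with \<open>y\<^sub>2 = h x\<close> this accounts for
  every stationarity condition except the one on the gradient of the Lagrangian. For that one,
  the Moreau envelope has gradient \<open>(v - prox v) / \<mu>\<close> at \<open>v\<close>
  (lemma \<open>gradient_moreau_envelope\<close>); when \<open>prox v = x\<close> it equals \<open>\<alpha>\<close>, and the equilibrium
  equation becomes the missing condition.

  The characterisation has two halves. A subgradient \<open>(v - p) / \<mu>\<close> at \<open>p\<close> forces the objective
  to grow quadratically away from \<open>p\<close>, so \<open>p\<close> is its only minimiser. Conversely, some such \<open>p\<close>
  exists: a closed proper convex function has an affine minorant, hence the objective is coercive
  and attains its minimum, and comparing the minimiser with nearby points on segments yields the
  subgradient inequality. The arguments are carried out on the epigraph, a closed convex subset of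
  a Euclidean space, which replaces lower semicontinuity and extended-real arithmetic by closedness
  and real arithmetic.
\<close>

section \<open>Subgradients and the epigraph\<close>

lemma proper_ext_finite_value:
  assumes "proper_ext g" "x \<in> dom_ext g"
  obtains c where "g x = ereal c"
  using assms by (cases "g x") (auto simp: proper_ext_def dom_ext_def)

lemma epigraph_ext_imp_dom: "(z, r) \<in> epigraph_ext g \<Longrightarrow> z \<in> dom_ext g"
  using le_less_trans[of "g z" "ereal r" \<infinity>] by (simp add: epigraph_ext_def dom_ext_def)

text \<open>A subgradient can exist only at a point of the domain, because the domain is nonempty and
  the value \<open>\<infinity>\<close> at the base point would violate the inequality there.\<close>

lemma subdifferential_iff_epigraph:
  assumes g: "proper_ext g"
  shows "s \<in> subdifferential g p \<longleftrightarrow>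
    (\<exists>c. g p = ereal c \<and> (\<forall>z r. (z, r) \<in> epigraph_ext g \<longrightarrow> c + s \<bullet> (z - p) \<le> r))"
proof
  assume s: "s \<in> subdifferential g p"
  obtain z0 where z0: "z0 \<in> dom_ext g"
    using g by (auto simp: proper_ext_def)
  have "g p + ereal (s \<bullet> (z0 - p)) \<le> g z0" "g z0 < \<infinity>"
    using s z0 by (auto simp: subdifferential_def dom_ext_def)
  then have "p \<in> dom_ext g"
    by (cases "g p") (auto simp: dom_ext_def)
  then obtain c where c: "g p = ereal c"
    by (rule proper_ext_finite_value[OF g])
  have "c + s \<bullet> (z - p) \<le> r" if "(z, r) \<in> epigraph_ext g" for z r
  proof -
    have zr: "g z \<le> ereal r"
      using that by (simp add: epigraph_ext_def)
    have "z \<in> dom_ext g"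
      using that by (rule epigraph_ext_imp_dom)
    then have "g p + ereal (s \<bullet> (z - p)) \<le> g z"
      using s by (auto simp: subdifferential_def)
    also note zr
    finally show ?thesis
      by (simp add: c)
  qed
  with c show "\<exists>c. g p = ereal c \<and> (\<forall>z r. (z, r) \<in> epigraph_ext g \<longrightarrow> c + s \<bullet> (z - p) \<le> r)"
    by blast
next
  assume "\<exists>c. g p = ereal c \<and> (\<forall>z r. (z, r) \<in> epigraph_ext g \<longrightarrow> c + s \<bullet> (z - p) \<le> r)"
  then obtain c where c: "g p = ereal c"
    and ineq: "\<And>z r. (z, r) \<in> epigraph_ext g \<Longrightarrow> c + s \<bullet> (z - p) \<le> r"
    by blast
  have "g p + ereal (s \<bullet> (z - p)) \<le> g z" if z: "z \<in> dom_ext g" for z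
  proof -
    obtain d where d: "g z = ereal d"
      using g z by (rule proper_ext_finite_value)
    then show ?thesis
      using ineq[of z d] by (simp add: c epigraph_ext_def)
  qed
  then show "s \<in> subdifferential g p"
    by (simp add: subdifferential_def)
qed

text \<open>Separate the epigraph from a point strictly below its graph. The separating hyperplane
  cannot be vertical, because the vertical line through that point meets the epigraph; solving
  its equation for the last coordinate gives the minorant.\<close>

lemma closed_convex_ext_affine_minorant:
  fixes g :: "'a::euclidean_space \<Rightarrow> ereal"
  assumes "closed_ext g" "proper_ext g" "convex_ext g"
  obtains a b where "\<And>z r. (z, r) \<in> epigraph_ext g \<Longrightarrow> a \<bullet> z + b \<le> r"
proof -
  obtain x0 where "x0 \<in> dom_ext g"
    using assms(2) by (auto simp: proper_ext_def)
  then obtain c where c: "g x0 = ereal c"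
    by (rule proper_ext_finite_value[OF assms(2)])
  have "(x0, c - 1) \<notin> epigraph_ext g"
    by (simp add: epigraph_ext_def c)
  then obtain w b where sep: "w \<bullet> (x0, c - 1) < b" "\<forall>q\<in>epigraph_ext g. w \<bullet> q > b"
    using separating_hyperplane_closed_point[of "epigraph_ext g" "(x0, c - 1)"] assms(1,3)
    by (auto simp: convex_ext_def closed_ext_def)
  obtain u s where w: "w = (u, s)"
    by (cases w)
  have above: "b < u \<bullet> z + s * r" if "(z, r) \<in> epigraph_ext g" for z r
    using bspec[OF sep(2) that] by (simp add: w)
  have "b < u \<bullet> x0 + s * c"
    by (rule above) (simp add: epigraph_ext_def c)
  moreover have "u \<bullet> x0 + s * (c - 1) < b"
    using sep(1) by (simp add: w)
  ultimately have "s * (c - 1) < s * c"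
    by linarith
  then have s: "s > 0"
    by (simp add: algebra_simps)
  have "(- (1 / s) *\<^sub>R u) \<bullet> z + b / s \<le> r" if "(z, r) \<in> epigraph_ext g" for z r
    using above[OF that] s by (simp add: field_simps)
  then show ?thesis
    by (rule that)
qed

section \<open>The proximal point\<close>

text \<open>Moving from the minimiser \<open>p\<close> a fraction \<open>t\<close> towards \<open>z\<close> changes \<open>g\<close> by at most
  \<open>t (r - c)\<close>, by convexity, and the quadratic term by its linear part plus \<open>O(t\<^sup>2)\<close>. Dividing
  by \<open>t\<close> and letting \<open>t\<close> tend to \<open>0\<close> leaves the subgradient inequality.\<close>

lemma epigraph_minimizer_imp_subgradient_inequality:
  fixes p v z :: "'a::real_inner"
  assumes E: "convex E" and p: "(p, c) \<in> E" and z: "(z, r) \<in> E" and \<mu>: "\<mu> > 0"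
    and min: "\<And>z r. (z, r) \<in> E \<Longrightarrow>
      c + 1 / (2 * \<mu>) * (norm (p - v))\<^sup>2 \<le> r + 1 / (2 * \<mu>) * (norm (z - v))\<^sup>2"
  shows "c + (v - p) \<bullet> (z - p) / \<mu> \<le> r"
proof -
  define k where "k = r - c - (v - p) \<bullet> (z - p) / \<mu>"
  define m where "m = 1 / (2 * \<mu>) * (norm (z - p))\<^sup>2"
  have step: "0 \<le> k + t * m" if t: "0 < t" "t < 1" for t
  proof -
    have "(1 - t) *\<^sub>R (p, c) + t *\<^sub>R (z, r) \<in> E"
      using E p z t by (intro convexD) auto
    then have "(p + t *\<^sub>R (z - p), c + t * (r - c)) \<in> E"
      by (simp add: algebra_simps)
    from min[OF this]
    have "1 / (2 * \<mu>) * (norm (p - v))\<^sup>2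
        \<le> t * (r - c) + 1 / (2 * \<mu>) * (norm ((p - v) + t *\<^sub>R (z - p)))\<^sup>2"
      by (simp add: algebra_simps)
    moreover have "(norm ((p - v) + t *\<^sub>R (z - p)))\<^sup>2
        = (norm (p - v))\<^sup>2 - 2 * t * ((v - p) \<bullet> (z - p)) + t\<^sup>2 * (norm (z - p))\<^sup>2"
      unfolding power2_norm_eq_inner
      by (simp add: inner_add_left inner_add_right inner_diff_left inner_diff_right
          inner_commute algebra_simps power2_eq_square)
    ultimately have "0 \<le> t * (k + t * m)"
      using \<mu> by (simp add: k_def m_def field_simps power2_eq_square)
    then show ?thesis
      using t by (simp add: zero_le_mult_iff)
  qed
  have "((\<lambda>t. k + t * m) \<longlongrightarrow> k + 0 * m) (at_right 0)"
    by (intro tendsto_intros)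
  moreover have "\<forall>\<^sub>F t in at_right (0::real). 0 \<le> k + t * m"
    using step by (auto simp: eventually_at_right_field intro: exI[of _ 1])
  ultimately have "0 \<le> k + 0 * m"
    by (intro tendsto_lowerbound) auto
  then show ?thesis
    by (simp add: k_def)
qed

text \<open>Minimise the continuous function \<open>(z, r) \<mapsto> r + \<parallel>z - v\<parallel>\<^sup>2 / (2 \<mu>)\<close> over the closed epigraph.
  The affine minorant bounds its sublevel sets, since a quadratic outgrows a linear term.\<close>

lemma exists_proximal_subgradient:
  fixes g :: "'a::euclidean_space \<Rightarrow> ereal"
  assumes g: "closed_ext g" "proper_ext g" "convex_ext g" and \<mu>: "\<mu> > 0"
  obtains p where "(1 / \<mu>) *\<^sub>R (v - p) \<in> subdifferential g p"
proof -
  define F where "F = (\<lambda>(z, r). r + 1 / (2 * \<mu>) * (norm (z - v))\<^sup>2)"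
  have F: "F (z, r) = r + 1 / (2 * \<mu>) * (norm (z - v))\<^sup>2" for z r
    by (simp add: F_def)
  have cont: "continuous_on A F" for A
    unfolding F_def case_prod_unfold by (intro continuous_intros)
  obtain a b where ab: "\<And>z r. (z, r) \<in> epigraph_ext g \<Longrightarrow> a \<bullet> z + b \<le> r"
    using closed_convex_ext_affine_minorant[OF g] by blast
  obtain x0 where "x0 \<in> dom_ext g"
    using g(2) by (auto simp: proper_ext_def)
  then obtain c0 where "g x0 = ereal c0"
    by (rule proper_ext_finite_value[OF g(2)])
  then have x0: "(x0, c0) \<in> epigraph_ext g"
    by (simp add: epigraph_ext_def)
  define K where "K = F (x0, c0)"
  define S where "S = {q \<in> epigraph_ext g. F q \<le> K}"
  \<comment> \<open>On a sublevel set the minorant gives \<open>N\<^sup>2 \<le> 2 \<mu> (k + \<parallel>a\<parallel> N)\<close> for \<open>N = \<parallel>z - v\<parallel>\<close>, and \<open>R\<close> bounds every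
    such \<open>N\<close>: for \<open>N > 1\<close> divide by \<open>N\<close>.\<close>
  define k where "k = K - b - a \<bullet> v"
  define R where "R = 1 + 2 * \<mu> * (\<bar>k\<bar> + norm a)"
  have bound: "norm (z - v) \<le> R \<and> a \<bullet> v + b - norm a * R \<le> r \<and> r \<le> K" if q: "(z, r) \<in> S" for z r
  proof -
    define N where "N = norm (z - v)"
    have N0: "0 \<le> N"
      by (simp add: N_def)
    have r: "a \<bullet> z + b \<le> r" and le: "r + 1 / (2 * \<mu>) * N\<^sup>2 \<le> K"
      using q ab by (auto simp: S_def F N_def)
    have az: "a \<bullet> z \<ge> a \<bullet> v - norm a * N"
      using norm_cauchy_schwarz[of "- a" "z - v"] by (simp add: N_def inner_diff_right)
    have "1 / (2 * \<mu>) * N\<^sup>2 \<le> \<bar>k\<bar> + norm a * N"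
      using r le az by (simp add: k_def)
    then have sq: "N * N \<le> 2 * \<mu> * (\<bar>k\<bar> + norm a * N)"
      using \<mu> by (simp add: field_simps power2_eq_square)
    have NR: "N \<le> R"
    proof (cases "N \<le> 1")
      case True
      moreover have "0 \<le> 2 * \<mu> * (\<bar>k\<bar> + norm a)"
        using \<mu> by simp
      ultimately show ?thesis
        unfolding R_def by linarith
    next
      case False
      then have "\<bar>k\<bar> + norm a * N \<le> (\<bar>k\<bar> + norm a) * N"
        using mult_left_mono[of 1 N "\<bar>k\<bar>"] by (simp add: algebra_simps)
      then have "2 * \<mu> * (\<bar>k\<bar> + norm a * N) \<le> 2 * \<mu> * ((\<bar>k\<bar> + norm a) * N)"
        using \<mu> by (intro mult_left_mono) auto
      with sq have "N * N \<le> (2 * \<mu> * (\<bar>k\<bar> + norm a)) * N"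
        by (simp add: mult.assoc)
      then have "N \<le> 2 * \<mu> * (\<bar>k\<bar> + norm a)"
        using False by (auto dest: mult_right_le_imp_le)
      then show ?thesis
        by (simp add: R_def)
    qed
    have "norm a * N \<le> norm a * R"
      using NR by (intro mult_left_mono) auto
    moreover have "0 \<le> 1 / (2 * \<mu>) * N\<^sup>2"
      using \<mu> by simp
    ultimately show ?thesis
      using NR r az le by (auto simp: N_def)
  qed
  have "bounded S"
  proof (rule bounded_subset)
    show "bounded (cball v R \<times> {a \<bullet> v + b - norm a * R..K})"
      by (intro bounded_Times bounded_cball bounded_closed_interval)
    show "S \<subseteq> cball v R \<times> {a \<bullet> v + b - norm a * R..K}"
      using bound by (auto simp: dist_norm norm_minus_commute)
  qed
  moreover have "closed S"
  proof -
    have "closed {q. F q \<le> K}"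
      by (intro closed_Collect_le cont continuous_on_const)
    then have "closed (epigraph_ext g \<inter> {q. F q \<le> K})"
      using g(1) by (auto simp: closed_ext_def)
    then show ?thesis
      by (simp add: S_def Int_def)
  qed
  ultimately have "compact S"
    by (simp add: compact_eq_bounded_closed)
  moreover have "(x0, c0) \<in> S"
    using x0 by (simp add: S_def K_def)
  ultimately obtain q where q: "q \<in> S" "\<forall>q'\<in>S. F q \<le> F q'"
    using continuous_attains_inf[OF _ _ cont, of S] by blast
  have min: "F q \<le> F q'" if "q' \<in> epigraph_ext g" for q'
  proof (cases "F q' \<le> K")
    case True
    with q(2) that show ?thesis
      unfolding S_def by blast
  next
    case False
    with q(1) show ?thesis
      unfolding S_def by simp
  qed
  obtain p d where pd: "q = (p, d)"
    by (cases q)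
  have pd_epi: "(p, d) \<in> epigraph_ext g"
    using q pd by (simp add: S_def)
  obtain c where c: "g p = ereal c"
    using g(2) epigraph_ext_imp_dom[OF pd_epi] by (rule proper_ext_finite_value)
  have pc: "(p, c) \<in> epigraph_ext g"
    by (simp add: epigraph_ext_def c)
  have "c \<le> d"
    using pd_epi by (simp add: epigraph_ext_def c)
  then have minc: "c + 1 / (2 * \<mu>) * (norm (p - v))\<^sup>2 \<le> r + 1 / (2 * \<mu>) * (norm (z - v))\<^sup>2"
    if "(z, r) \<in> epigraph_ext g" for z r
    using min[OF that] by (simp add: pd F)
  have "c + ((1 / \<mu>) *\<^sub>R (v - p)) \<bullet> (z - p) \<le> r" if "(z, r) \<in> epigraph_ext g" for z r
    using epigraph_minimizer_imp_subgradient_inequality[OF _ pc that \<mu> minc] g(3)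
    by (simp add: convex_ext_def inner_scaleR_left)
  then have "(1 / \<mu>) *\<^sub>R (v - p) \<in> subdifferential g p"
    using c by (auto simp: subdifferential_iff_epigraph[OF g(2)])
  then show ?thesis
    by (rule that)
qed

text \<open>Completing the square in the subgradient inequality at \<open>p\<close>. The proximal objective is
  centred at a point \<open>w\<close> that may differ from \<open>v\<close>: the case \<open>w = v\<close> makes \<open>p\<close> the unique minimiser,
  and varying \<open>w\<close> gives the lower bound that differentiates the envelope.\<close>

lemma prox_objective_lower_bound:
  fixes g :: "'a::real_inner \<Rightarrow> ereal"
  assumes g: "proper_ext g" and \<mu>: "\<mu> > 0"
    and s: "(1 / \<mu>) *\<^sub>R (v - p) \<in> subdifferential g p"
  shows "prox_objective \<mu> g w z \<ge> prox_objective \<mu> g v p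
    + ereal ((v - p) \<bullet> (w - v) / \<mu> + 1 / (2 * \<mu>) * (norm ((z - p) - (w - v)))\<^sup>2)"
proof -
  obtain c where c: "g p = ereal c"
    and ineq: "\<And>z r. (z, r) \<in> epigraph_ext g \<Longrightarrow> c + ((1 / \<mu>) *\<^sub>R (v - p)) \<bullet> (z - p) \<le> r"
    using s by (auto simp: subdifferential_iff_epigraph[OF g])
  show ?thesis
  proof (cases "z \<in> dom_ext g")
    case False
    then show ?thesis
      by (simp add: dom_ext_def prox_objective_def c)
  next
    case True
    then obtain d where d: "g z = ereal d"
      by (rule proper_ext_finite_value[OF g])
    define e where "e = (z - p) - (w - v)"
    have "(norm (z - w))\<^sup>2 = (norm (p - v))\<^sup>2 - 2 * ((v - p) \<bullet> e) + (norm e)\<^sup>2"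
    proof -
      have "z - w = e - (v - p)"
        by (simp add: e_def)
      moreover have "norm (p - v) = norm (v - p)"
        by (rule norm_minus_commute)
      ultimately show ?thesis
        by (simp only: power2_norm_eq_inner)
          (simp add: inner_diff_left inner_diff_right inner_commute algebra_simps)
    qed
    then have "1 / (2 * \<mu>) * (norm (z - w))\<^sup>2
        = 1 / (2 * \<mu>) * (norm (p - v))\<^sup>2 - (v - p) \<bullet> e / \<mu> + 1 / (2 * \<mu>) * (norm e)\<^sup>2"
      using \<mu> by (simp add: field_simps)
    moreover have "(v - p) \<bullet> (z - p) / \<mu> = (v - p) \<bullet> e / \<mu> + (v - p) \<bullet> (w - v) / \<mu>"
      by (simp add: e_def inner_diff_right add_divide_distrib[symmetric])
    moreover have "c + (v - p) \<bullet> (z - p) / \<mu> \<le> d"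
      using ineq[of z d] by (simp add: d epigraph_ext_def)
    ultimately have "c + 1 / (2 * \<mu>) * (norm (p - v))\<^sup>2
        + ((v - p) \<bullet> (w - v) / \<mu> + 1 / (2 * \<mu>) * (norm e)\<^sup>2)
        \<le> d + 1 / (2 * \<mu>) * (norm (z - w))\<^sup>2"
      by linarith
    then show ?thesis
      by (simp add: prox_objective_def c d e_def)
  qed
qed

lemma prox_eqI:
  fixes g :: "'a::real_inner \<Rightarrow> ereal"
  assumes g: "proper_ext g" and \<mu>: "\<mu> > 0"
    and s: "(1 / \<mu>) *\<^sub>R (v - p) \<in> subdifferential g p"
  shows "prox \<mu> g v = p"
proof -
  obtain c where c: "g p = ereal c"
    using s by (auto simp: subdifferential_iff_epigraph[OF g])
  define m where "m = c + 1 / (2 * \<mu>) * (norm (p - v))\<^sup>2"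
  have m: "prox_objective \<mu> g v p = ereal m"
    by (simp add: prox_objective_def c m_def)
  have growth: "ereal (m + 1 / (2 * \<mu>) * (norm (z - p))\<^sup>2) \<le> prox_objective \<mu> g v z" for z
    using prox_objective_lower_bound[OF g \<mu> s, of v z] by (simp add: m)
  have less: "ereal m < prox_objective \<mu> g v z" if "z \<noteq> p" for z
  proof -
    have "ereal m < ereal (m + 1 / (2 * \<mu>) * (norm (z - p))\<^sup>2)"
      using that \<mu> by simp
    then show ?thesis
      using growth[of z] by (rule less_le_trans)
  qed
  have "is_arg_min (prox_objective \<mu> g v) (\<lambda>_. True) z \<longleftrightarrow> z = p" for z
    using less m by (metis is_arg_min_def less_asym)
  then show ?thesis
    by (simp add: prox_def arg_min_def)
qed

text \<open>The forward direction needs that a minimiser exists at all, since \<open>prox\<close> is a choice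
  operator.\<close>

lemma prox_eq_iff_subgradient:
  fixes g :: "'a::euclidean_space \<Rightarrow> ereal"
  assumes g: "closed_ext g" "proper_ext g" "convex_ext g" and \<mu>: "\<mu> > 0"
  shows "prox \<mu> g v = p \<longleftrightarrow> (1 / \<mu>) *\<^sub>R (v - p) \<in> subdifferential g p"
  using exists_proximal_subgradient[OF g \<mu>, of v] prox_eqI[OF g(2) \<mu>, of v] by metis

section \<open>The gradient of the Moreau envelope\<close>

lemma gradient_eqI:
  assumes "GDERIV F x :> D"
  shows "gradient F x = D"
proof -
  have "D' = D" if "GDERIV F x :> D'" for D'
  proof -
    have "(\<lambda>h. h \<bullet> D') = (\<lambda>h. h \<bullet> D)"
      using assms that unfolding gderiv_def by (blast intro: has_derivative_unique)
    then have "\<And>h. h \<bullet> (D' - D) = 0"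
      by (metis inner_diff_right diff_self)
    then show ?thesis
      by (metis inner_eq_zero_iff right_minus_eq)
  qed
  with assms show ?thesis
    unfolding gradient_def by blast
qed

lemma GDERIV_from_quadratic_bound:
  fixes F :: "'a::real_inner \<Rightarrow> real"
  assumes "\<And>w. \<bar>F w - F v - (w - v) \<bullet> D\<bar> \<le> C * (norm (w - v))\<^sup>2"
  shows "GDERIV F v :> D"
  unfolding gderiv_def has_derivative_at
proof (intro conjI)
  show "bounded_linear (\<lambda>h. h \<bullet> D)"
    by (rule bounded_linear_inner_left)
  show "(\<lambda>h. norm (F (v + h) - F v - h \<bullet> D) / norm h) \<midarrow>0\<rightarrow> 0"
  proof (rule Lim_null_comparison)
    have "norm (norm (F (v + h) - F v - h \<bullet> D) / norm h) \<le> C * norm h" if "h \<noteq> 0" for h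
      using assms[of "v + h"] that by (simp add: field_simps power2_eq_square)
    then show "\<forall>\<^sub>F h in at 0. norm (norm (F (v + h) - F v - h \<bullet> D) / norm h) \<le> C * norm h"
      by (simp add: eventually_at_filter)
    have "(\<lambda>h::'a. C * norm h) \<midarrow>0\<rightarrow> C * norm (0::'a)"
      by (intro tendsto_intros)
    then show "(\<lambda>h::'a. C * norm h) \<midarrow>0\<rightarrow> 0"
      by simp
  qed
qed

text \<open>With \<open>p = prox \<mu> g v\<close> and \<open>s = (v - p) / \<mu>\<close>, the envelope satisfies
  \<open>0 \<le> M w - M v - s \<bullet> (w - v) \<le> \<parallel>w - v\<parallel>\<^sup>2 / (2 \<mu>)\<close>. The upper bound tests the infimum defining
  \<open>M w\<close> with the point \<open>p\<close>; the lower bound is the subgradient inequality at \<open>p\<close> after completing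
  the square.\<close>

lemma gradient_moreau_envelope:
  fixes g :: "'a::euclidean_space \<Rightarrow> ereal"
  assumes g: "closed_ext g" "proper_ext g" "convex_ext g" and \<mu>: "\<mu> > 0"
  shows "gradient (moreau_envelope \<mu> g) v = (1 / \<mu>) *\<^sub>R (v - prox \<mu> g v)"
proof -
  define p where "p = prox \<mu> g v"
  define s where "s = (1 / \<mu>) *\<^sub>R (v - p)"
  have s: "s \<bullet> u = (v - p) \<bullet> u / \<mu>" for u
    by (simp add: s_def)
  have sub: "(1 / \<mu>) *\<^sub>R (v - p) \<in> subdifferential g p"
    unfolding p_def using prox_eq_iff_subgradient[OF g \<mu>] by blast
  then obtain c where c: "g p = ereal c"
    by (auto simp: subdifferential_iff_epigraph[OF g(2)])
  define m where "m = c + 1 / (2 * \<mu>) * (norm (p - v))\<^sup>2"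
  have m: "prox_objective \<mu> g v p = ereal m"
    by (simp add: prox_objective_def c m_def)
  let ?M = "moreau_envelope \<mu> g"
  have bounds: "m + s \<bullet> (w - v) \<le> ?M w \<and> ?M w \<le> m + s \<bullet> (w - v) + 1 / (2 * \<mu>) * (norm (w - v))\<^sup>2"
    for w
  proof -
    define I where "I = (INF z. prox_objective \<mu> g w z)"
    have "ereal (m + s \<bullet> (w - v)) \<le> prox_objective \<mu> g w z" for z
    proof -
      have "ereal (m + s \<bullet> (w - v))
          \<le> ereal (m + (s \<bullet> (w - v) + 1 / (2 * \<mu>) * (norm ((z - p) - (w - v)))\<^sup>2))"
        using \<mu> by simp
      also have "\<dots> \<le> prox_objective \<mu> g w z"
        using prox_objective_lower_bound[OF g(2) \<mu> sub, of w z] by (simp add: m s)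
      finally show ?thesis .
    qed
    then have lower: "ereal (m + s \<bullet> (w - v)) \<le> I"
      unfolding I_def by (intro INF_greatest)
    have "c + 1 / (2 * \<mu>) * (norm (p - w))\<^sup>2
        = m + s \<bullet> (w - v) + 1 / (2 * \<mu>) * (norm (w - v))\<^sup>2"
    proof -
      have "p - w = - ((v - p) + (w - v))"
        by simp
      then have "(norm (p - w))\<^sup>2 = (norm ((v - p) + (w - v)))\<^sup>2"
        by (simp only: norm_minus_cancel)
      also have "\<dots> = (norm (p - v))\<^sup>2 + 2 * ((v - p) \<bullet> (w - v)) + (norm (w - v))\<^sup>2"
        unfolding norm_minus_commute[of p v] power2_norm_eq_inner
        by (simp only: inner_add_left inner_add_right) (simp add: inner_commute)
      finally show ?thesis
        using \<mu> by (simp add: m_def s field_simps)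
    qed
    moreover have "I \<le> prox_objective \<mu> g w p"
      unfolding I_def by (rule INF_lower) simp
    ultimately have upper: "I \<le> ereal (m + s \<bullet> (w - v) + 1 / (2 * \<mu>) * (norm (w - v))\<^sup>2)"
      by (simp add: prox_objective_def c)
    have "?M w = real_of_ereal I"
      by (simp add: moreau_envelope_def I_def)
    then show ?thesis
      using lower upper by (cases I) auto
  qed
  have Mv: "?M v = m"
    using bounds[of v] by simp
  have "GDERIV ?M v :> s"
  proof (rule GDERIV_from_quadratic_bound)
    show "\<bar>?M w - ?M v - (w - v) \<bullet> s\<bar> \<le> 1 / (2 * \<mu>) * (norm (w - v))\<^sup>2" for w
      using bounds[of w] by (simp add: Mv inner_commute abs_le_iff)
  qed
  then show ?thesis
    unfolding s_def p_def by (rule gradient_eqI)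
qed

section \<open>Equilibria with zero output\<close>

lemma stack_eq_0_iff: "stack u w = 0 \<longleftrightarrow> u = 0 \<and> w = 0"
proof
  assume "stack u w = 0"
  then have "(case i of Inl j \<Rightarrow> u $ j | Inr k \<Rightarrow> w $ k) = 0" for i
    by (simp add: stack_def vec_eq_iff)
  from this[of "Inl _"] this[of "Inr _"] show "u = 0 \<and> w = 0"
    by (simp add: vec_eq_iff)
next
  assume "u = 0 \<and> w = 0"
  then show "stack u w = 0"
    by (simp add: stack_def vec_eq_iff split: sum.split)
qed

theorem lemma1:
  fixes f :: "real^'n \<Rightarrow> real"
    and h :: "real^'n \<Rightarrow> real^'m"
    and g :: "real^'n \<Rightarrow> ereal"
    and \<mu> :: real
    and x \<alpha> :: "real^'n" and l :: "real^'m"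
    and y :: "real^('n + 'm)"
  assumes "continuously_differentiable f"
    and "continuously_differentiable h"
    and "closed_ext g" and "proper_ext g" and "convex_ext g"
    and "\<not> differentiable_ext g"
    and "\<mu> > 0"
    and "equilibrium_point f g h \<mu> x \<alpha> l"
    and "y = system_output g h \<mu> x \<alpha>"
  shows "stationary_point f g h x \<alpha> l \<longleftrightarrow> y = 0"
proof -
  note g = assms(3-5) and \<mu> = assms(7)
  let ?v = "x + \<mu> *\<^sub>R \<alpha>"
  have prox_x: "prox \<mu> g ?v = x \<longleftrightarrow> \<alpha> \<in> subdifferential g x"
    using prox_eq_iff_subgradient[OF g \<mu>, of ?v x] \<mu> by simp
  have y: "y = 0 \<longleftrightarrow> prox \<mu> g ?v = x \<and> h x = 0"
    by (auto simp: assms(9) system_output_def stack_eq_0_iff output1_def output2_def)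
  have "gradient f x + \<alpha> + transpose (jacobian h (at x)) *v l = 0" if "prox \<mu> g ?v = x"
  proof -
    have "gradient (moreau_envelope \<mu> g) ?v = \<alpha>"
      using gradient_moreau_envelope[OF g \<mu>, of ?v] \<mu> by (simp add: that)
    then show ?thesis
      using assms(8) by (simp add: equilibrium_point_def)
  qed
  then show ?thesis
    by (auto simp: stationary_point_def y prox_x)
qed

end
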